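(* Let $\pi_1,\pi_2>0$ with $\pi_1+\pi_2=1$ be the prior probabilities of $H_1:Q=P_1$ and $H_2:Q=P_2$, and assume $C(P_1,P_2)>0$. For each $n\ge2$ let $G_n$ be any connected undirected graph on $n$ nodes with $m=m_n$ edges, let $y_1,\dots,y_n$ be i.i.d. $\sim Q$ with node $i$ observing $y_i$, and run BQ-CADMM on $G_n$ with local data $r_i=\log\frac{dP_1}{dP_2}(y_i)$, quantizer parameters $a=-1$, $\Delta=2$, $\delta=1$ (so the quantizer threshold is $0$), and $\rho=\frac{1}{12n^2}$. Let $$\mathcal A_n=\{y^n:\text{BQ-CADMM cycles}\}\cup\{y^n:\text{BQ-CADMM converges at }1\},$$ and $\alpha_n=P_1(\mathcal A_n^c)$, $\beta_n=P_2(\mathcal A_n)$. Then $$\liminf_{n\to\infty}-\frac1n\log(\pi_1\alpha_n+\pi_2\beta_n)=C(P_1,P_2).$$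
   Context: $P_1,P_2$ are mutually absolutely continuous probability measures on a Polish space (or finite set) $\Sigma$; $\log$ is the natural logarithm; probabilities of subsets of $\Sigma^n$ refer to product measures. The Chernoff information is $C(P_1,P_2)=-\min_{0\le\lambda\le1}\log\int_\Sigma p_1^\lambda p_2^{1-\lambda}$, where $p_j$ are densities with respect to a common dominating measure. Network and algorithm: $G$ is a connected undirected simple graph on nodes $\{1,\dots,n\}$ with $m$ edges; $\mathcal N_i$ is the set of neighbors of node $i$ ($i\notin\mathcal N_i$). Given $a\in\mathbb R$, $\Delta>0$, $\delta\in(0,\Delta)$, the $\delta$-quantizer is $\mathcal Q_\delta(x)=a$ if $x\le a+\Delta-\delta$ and $a+\Delta$ otherwise. Given local data $r_1,\dots,r_n\in\mathbb R$ and $\rho>0$, BQ-CADMM is the deterministic iteration with $x_i^0=0$, $\alpha_i^0=0$ and, for $k\ge0$, $$x_i^{k+1}=\frac{1}{1+2\rho|\mathcal N_i|}\Big(\rho|\mathcal N_i|\mathcal Q_\delta(x_i^k)+\rho\sum_{j\in\mathcal N_i}\mathcal Q_\delta(x_j^k)-\alpha_i^k+r_i\Big),\quad \alpha_i^{k+1}=\alpha_i^k+\rho\Big(|\mathcal N_i|\mathcal Q_\delta(x_i^{k+1})-\sum_{j\in\mathcal N_i}\mathcal Q_\delta(x_j^{k+1})\Big).$$ BQ-CADMM "converges at $c$" if there is $k_0$ with $\mathcal Q_\delta(x_i^k)=c$ for all $i$ and all $k\ge k_0$; it "cycles" if it converges at neither $a$ nor $a+\Delta$. *)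

theory Defs
  imports "HOL-Probability.Probability"
begin

definition quant :: "real \<Rightarrow> real \<Rightarrow> real \<Rightarrow> real \<Rightarrow> real" where
  "quant a Delta delta x = (if x \<le> a + Delta - delta then a else a + Delta)"

definition simple_graph_on :: "nat \<Rightarrow> (nat \<Rightarrow> nat \<Rightarrow> bool) \<Rightarrow> bool" where
  "simple_graph_on n E \<longleftrightarrow>
     (\<forall>i j. E i j \<longrightarrow> i < n \<and> j < n) \<and> (\<forall>i j. E i j \<longrightarrow> E j i) \<and> (\<forall>i. \<not> E i i)"

definition connected_graph :: "nat \<Rightarrow> (nat \<Rightarrow> nat \<Rightarrow> bool) \<Rightarrow> bool" where
  "connected_graph n E \<longleftrightarrow> simple_graph_on n E \<and> (\<forall>i<n. \<forall>j<n. E\<^sup>*\<^sup>* i j)"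

definition nbrs :: "nat \<Rightarrow> (nat \<Rightarrow> nat \<Rightarrow> bool) \<Rightarrow> nat \<Rightarrow> nat set" where
  "nbrs n E i = {j. j < n \<and> E i j}"

primrec bqcadmm :: "nat \<Rightarrow> (nat \<Rightarrow> nat \<Rightarrow> bool) \<Rightarrow> (real \<Rightarrow> real) \<Rightarrow> real \<Rightarrow> (nat \<Rightarrow> real)
    \<Rightarrow> nat \<Rightarrow> (nat \<Rightarrow> real) \<times> (nat \<Rightarrow> real)" where
  "bqcadmm n E Q \<rho> r 0 = ((\<lambda>_. 0), (\<lambda>_. 0))"
| "bqcadmm n E Q \<rho> r (Suc k) =
     (let x = fst (bqcadmm n E Q \<rho> r k);
          \<alpha> = snd (bqcadmm n E Q \<rho> r k);
          d = (\<lambda>i. real (card (nbrs n E i)));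
          x' = (\<lambda>i. (\<rho> * d i * Q (x i) + \<rho> * (\<Sum>j\<in>nbrs n E i. Q (x j)) - \<alpha> i + r i)
                     / (1 + 2 * \<rho> * d i));
          \<alpha>' = (\<lambda>i. \<alpha> i + \<rho> * (d i * Q (x' i) - (\<Sum>j\<in>nbrs n E i. Q (x' j))))
      in (x', \<alpha>'))"

definition converges_at :: "nat \<Rightarrow> (nat \<Rightarrow> nat \<Rightarrow> bool) \<Rightarrow> (real \<Rightarrow> real) \<Rightarrow> real \<Rightarrow> (nat \<Rightarrow> real)
    \<Rightarrow> real \<Rightarrow> bool" where
  "converges_at n E Q \<rho> r c \<longleftrightarrow>
     (\<exists>k0. \<forall>k\<ge>k0. \<forall>i<n. Q (fst (bqcadmm n E Q \<rho> r k) i) = c)"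

definition cycles :: "real \<Rightarrow> real \<Rightarrow> nat \<Rightarrow> (nat \<Rightarrow> nat \<Rightarrow> bool) \<Rightarrow> (real \<Rightarrow> real) \<Rightarrow> real
    \<Rightarrow> (nat \<Rightarrow> real) \<Rightarrow> bool" where
  "cycles a Delta n E Q \<rho> r \<longleftrightarrow>
     \<not> converges_at n E Q \<rho> r a \<and> \<not> converges_at n E Q \<rho> r (a + Delta)"

(* Chernoff information, computed from densities p1, p2 w.r.t. a common dominating measure mu *)
definition chernoff :: "'a measure \<Rightarrow> ('a \<Rightarrow> real) \<Rightarrow> ('a \<Rightarrow> real) \<Rightarrow> real" where
  "chernoff mu p1 p2 =
     - (INF l\<in>{0..1::real}. ln (\<integral>x. (p1 x) powr l * (p2 x) powr (1 - l) \<partial>mu))"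

definition neg_log_rate :: "nat \<Rightarrow> real \<Rightarrow> ereal" where
  "neg_log_rate n p = (if p = 0 then \<infinity> else ereal (- (1 / real n) * ln p))"

end

theory Submission
  imports Defs
begin

text \<open>Write \<open>S\<close> for the sum of the log-likelihood ratios \<open>r i\<close>. Put \<open>v i = r i - \<alpha> i\<close>; these always sum
  to \<open>S\<close>. While a node is quantized to \<open>-1\<close> its \<open>v i\<close> does not decrease, and whenever it is quantized
  to \<open>1\<close> its \<open>v i\<close> is at least \<open>-4 \<rho> deg i\<close>; so once every node has been at \<open>1\<close>, \<open>S \<ge> -4 \<rho> n\<^sup>2\<close>. If
  instead some node stays at \<open>-1\<close> forever, its \<open>v i\<close> is bounded and grows by at least \<open>2 \<rho>\<close> each time a neighbour
  is at \<open>1\<close>, so the neighbours end up at \<open>-1\<close> too, and by connectedness the algorithm converges at \<open>-1\<close>.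
  Convergence at \<open>-1\<close> forces \<open>S \<le> 2 \<rho> n\<^sup>2\<close>. Hence the decision is the likelihood ratio test up to a bounded
  error in \<open>S\<close>.

  For the error exponent let \<open>M\<close> be the minimum over \<open>\<lambda>\<close> of \<open>\<integral> p1\<^sup>\<lambda> p2\<^sup>1\<^sup>-\<^sup>\<lambda>\<close> and \<open>T\<close> the measure
  tilted at the minimiser. With respect to the product of \<open>T\<close>, both hypotheses have densities
  \<open>M\<^sup>n exp ((1 - \<lambda>) S)\<close> and \<open>M\<^sup>n exp (- \<lambda> S)\<close>. On the error events these are at most \<open>e M\<^sup>n\<close>; for the
  converse, \<open>S / n\<close> tends to \<open>0\<close> in probability under \<open>T\<close>, and both densities are at least
  \<open>M\<^sup>n exp (- n \<epsilon>)\<close> where \<open>\<bar>S\<bar> \<le> n \<epsilon>\<close>.\<close>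

subsection \<open>The iteration with sign quantizer\<close>

lemma quant_sign: "quant (-1) 2 1 x = (if x \<le> 0 then -1 else 1)"
  by (simp add: quant_def)

text \<open>A bounded increasing sequence converges, so its increments tend to 0.\<close>

lemma eventually_increment_less:
  fixes v :: "nat \<Rightarrow> real"
  assumes mono: "\<And>k. k \<ge> N \<Longrightarrow> v k \<le> v (Suc k)"
    and bdd: "\<And>k. k \<ge> N \<Longrightarrow> v k \<le> B" and "c > 0"
  shows "eventually (\<lambda>k. v (Suc k) < v k + c) sequentially"
proof -
  define w where "w k = v (k + N)" for k
  have "incseq w" using mono by (intro incseq_SucI) (simp add: w_def)
  moreover have "\<And>k. w k \<le> B" using bdd by (simp add: w_def)
  ultimately obtain L where "w \<longlonglongrightarrow> L" by (meson incseq_convergent)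
  then have "v \<longlonglongrightarrow> L" unfolding w_def by (rule LIMSEQ_offset)
  then have "(\<lambda>k. v (Suc k) - v k) \<longlonglongrightarrow> L - L" by (intro tendsto_diff LIMSEQ_Suc)
  then have "eventually (\<lambda>k. v (Suc k) - v k < c) sequentially"
    using \<open>c > 0\<close> by (intro order_tendstoD) auto
  then show ?thesis by eventually_elim simp
qed

locale sign_bqcadmm =
  fixes n :: nat and E :: "nat \<Rightarrow> nat \<Rightarrow> bool" and \<rho> :: real and r :: "nat \<Rightarrow> real"
  assumes connected: "connected_graph n E" and \<rho>_pos: "\<rho> > 0"
begin

definition q :: "nat \<Rightarrow> nat \<Rightarrow> real" where
  "q k i = quant (-1) 2 1 (fst (bqcadmm n E (quant (-1) 2 1) \<rho> r k) i)"

definition v :: "nat \<Rightarrow> nat \<Rightarrow> real" where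
  "v k i = r i - snd (bqcadmm n E (quant (-1) 2 1) \<rho> r k) i"

definition deg :: "nat \<Rightarrow> real" where "deg i = real (card (nbrs n E i))"

lemma simple: "simple_graph_on n E"
  using connected by (simp add: connected_graph_def)

lemma finite_nbrs [simp]: "finite (nbrs n E i)"
  by (simp add: nbrs_def)

lemma deg_nonneg: "0 \<le> deg i" by (simp add: deg_def)

lemma deg_le: "deg i \<le> real n"
proof -
  have "card (nbrs n E i) \<le> card {..<n}" by (intro card_mono) (auto simp: nbrs_def)
  then show ?thesis by (simp add: deg_def)
qed

lemma q_cases: "q k i = -1 \<or> q k i = 1"
  by (simp add: q_def quant_sign)

lemma q_abs: "-1 \<le> q k i" "q k i \<le> 1"
  using q_cases[of k i] by auto

lemma sum_nbrs_q: "- deg i \<le> (\<Sum>j\<in>nbrs n E i. q k j)" "(\<Sum>j\<in>nbrs n E i. q k j) \<le> deg i"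
  using sum_mono[of "nbrs n E i" "\<lambda>_. -1" "q k"] sum_mono[of "nbrs n E i" "q k" "\<lambda>_. 1"] q_abs
  by (auto simp: deg_def)

text \<open>The denominator of the update is positive, so the sign quantizer sees only the
  numerator. This eliminates \<open>x\<close>: from here on \<open>q\<close> and \<open>v\<close>
  carry the dynamics.\<close>

lemma q_Suc_eq_1_iff:
  "q (Suc k) i = 1 \<longleftrightarrow> 0 < \<rho> * deg i * q k i + \<rho> * (\<Sum>j\<in>nbrs n E i. q k j) + v k i"
proof -
  have "0 < 1 + 2 * \<rho> * deg i" using \<rho>_pos deg_nonneg[of i] by (simp add: add_pos_nonneg)
  then show ?thesis
    by (auto simp: q_def quant_sign v_def Let_def deg_def divide_le_0_iff zero_less_divide_iff
        not_le[symmetric])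
qed

lemma v_Suc: "v (Suc k) i = v k i - \<rho> * (deg i * q (Suc k) i - (\<Sum>j\<in>nbrs n E i. q (Suc k) j))"
  by (simp add: v_def q_def deg_def Let_def)

lemma v_0: "v 0 i = r i" by (simp add: v_def)

text \<open>Along an edge the increments at the two ends are opposite, so symmetry of
  \<open>E\<close> makes the total a conserved quantity.\<close>

lemma sum_v: "(\<Sum>i<n. v k i) = (\<Sum>i<n. r i)"
proof (induction k)
  case (Suc k)
  have nbr: "(\<Sum>j\<in>nbrs n E i. q (Suc k) j) = (\<Sum>j<n. if E i j then q (Suc k) j else 0)" for i
    by (simp add: nbrs_def sum.If_cases lessThan_def Collect_conj_eq)
  \<comment> \<open>The test reads \<open>E j i\<close>, not \<open>E i j\<close>: exchanging the
    sums then gives exactly the double sum coming from \<open>nbr\<close>.\<close>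
  have nbr': "deg i * q (Suc k) i = (\<Sum>j<n. if E j i then q (Suc k) i else 0)" for i
  proof -
    have "{..<n} \<inter> {j. E j i} = nbrs n E i"
      using simple by (auto simp: nbrs_def simple_graph_on_def)
    then have "(\<Sum>j<n. if E j i then q (Suc k) i else 0) = (\<Sum>j\<in>nbrs n E i. q (Suc k) i)"
      by (simp add: sum.If_cases)
    then show ?thesis by (simp add: deg_def)
  qed
  have "(\<Sum>i<n. deg i * q (Suc k) i) = (\<Sum>i<n. \<Sum>j\<in>nbrs n E i. q (Suc k) j)"
    unfolding nbr nbr' by (rule sum.swap)
  then show ?case
    using Suc by (simp add: v_Suc sum_subtractf flip: sum_distrib_left)
qed (simp add: v_0)

lemma v_mono:
  assumes "q (Suc k) i = -1"
  shows "v k i \<le> v (Suc k) i"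
proof -
  have "0 \<le> deg i + (\<Sum>j\<in>nbrs n E i. q (Suc k) j)" using sum_nbrs_q(1)[of i "Suc k"] by linarith
  then have "0 \<le> \<rho> * (deg i + (\<Sum>j\<in>nbrs n E i. q (Suc k) j))" using \<rho>_pos by simp
  then show ?thesis using assms by (simp add: v_Suc algebra_simps)
qed

text \<open>The increment is \<rho> times the sum of \<open>1 + q (Suc k) l\<close> over the
  neighbours; all terms are nonnegative and the one for \<open>j\<close> is 2.\<close>

lemma v_jump:
  assumes "q (Suc k) i = -1" "E i j" "q (Suc k) j = 1"
  shows "v k i + 2 * \<rho> \<le> v (Suc k) i"
proof -
  have j: "j \<in> nbrs n E i" using assms simple by (auto simp: nbrs_def simple_graph_on_def)
  have "0 \<le> 1 + q (Suc k) l" for l using q_abs(1)[of "Suc k" l] by linarith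
  then have "(\<Sum>l\<in>nbrs n E i. 1 + q (Suc k) l) \<ge> 1 + q (Suc k) j"
    by (intro member_le_sum[OF j]) auto
  then have "2 \<le> deg i + (\<Sum>l\<in>nbrs n E i. q (Suc k) l)"
    using assms by (simp add: sum.distrib deg_def)
  then have "\<rho> * 2 \<le> \<rho> * (deg i + (\<Sum>l\<in>nbrs n E i. q (Suc k) l))" using \<rho>_pos by simp
  then show ?thesis using assms by (simp add: v_Suc algebra_simps)
qed

text \<open>The node chooses -1 only if the numerator is at most 0, and the quantized terms in it
  are at least \<open>-2 * \<rho> * deg i\<close>.\<close>

lemma v_upper:
  assumes "q (Suc k) i = -1"
  shows "v k i \<le> 2 * \<rho> * deg i"
proof -
  have "\<rho> * deg i * q k i + \<rho> * (\<Sum>j\<in>nbrs n E i. q k j) + v k i \<le> 0"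
    using q_Suc_eq_1_iff[of k i] assms by force
  moreover have "- (\<rho> * deg i) \<le> \<rho> * (\<Sum>j\<in>nbrs n E i. q k j)"
    using mult_left_mono[OF sum_nbrs_q(1)[of i k], of \<rho>] \<rho>_pos by simp
  moreover have "\<rho> * deg i * q k i \<ge> \<rho> * deg i * (-1)"
    using \<rho>_pos deg_nonneg q_abs by (intro mult_left_mono) auto
  ultimately show ?thesis by linarith
qed

text \<open>A positive numerator gives \<open>v k i > -2 * \<rho> * deg i\<close>, and one update
  costs at most another \<open>2 * \<rho> * deg i\<close>.\<close>

lemma v_lower_after_1:
  assumes "q (Suc k) i = 1"
  shows "- (4 * \<rho> * deg i) \<le> v (Suc k) i"
proof -
  have "0 < \<rho> * deg i * q k i + \<rho> * (\<Sum>j\<in>nbrs n E i. q k j) + v k i"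
    using q_Suc_eq_1_iff[of k i] assms by force
  moreover have "\<rho> * (\<Sum>j\<in>nbrs n E i. q k j) \<le> \<rho> * deg i"
    "- (\<rho> * deg i) \<le> \<rho> * (\<Sum>j\<in>nbrs n E i. q (Suc k) j)"
    using mult_left_mono[OF sum_nbrs_q(2)[where k=k and i=i], of \<rho>]
      mult_left_mono[OF sum_nbrs_q(1)[of i "Suc k"], of \<rho>] \<rho>_pos by auto
  moreover have "\<rho> * deg i * q k i \<le> \<rho> * deg i * 1"
    using \<rho>_pos deg_nonneg q_abs by (intro mult_left_mono) auto
  ultimately show ?thesis using assms by (simp add: v_Suc algebra_simps)
qed

text \<open>Each later step either puts the node at -1, where \<open>v\<close> cannot drop, or at 1,
  where the one-step bound applies afresh.\<close>

lemma v_lower: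
  assumes "q (Suc k) i = 1" "Suc k \<le> l"
  shows "- (4 * \<rho> * deg i) \<le> v l i"
  using assms(2)
proof (induction l rule: dec_induct)
  case base
  then show ?case using v_lower_after_1[OF assms(1)] .
next
  case (step l)
  then show ?case using v_mono[of l i] v_lower_after_1[of l i] q_cases[of "Suc l" i] by linarith
qed

text \<open>With \<open>i\<close> frozen at -1, \<open>v\<close> at \<open>i\<close> is increasing
  and bounded, so its steps finally fall below \<open>2 * \<rho>\<close>; a neighbour at 1 would
  force a jump of that size.\<close>

lemma eventually_neg_nbr:
  assumes "eventually (\<lambda>k. q k i = -1) sequentially" "E i j"
  shows "eventually (\<lambda>k. q k j = -1) sequentially"
proof -
  obtain k0 where k0: "\<And>k. k \<ge> k0 \<Longrightarrow> q k i = -1"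
    using assms by (auto simp: eventually_sequentially)
  have "eventually (\<lambda>k. v (Suc k) i < v k i + 2 * \<rho>) sequentially"
    using \<rho>_pos by (intro eventually_increment_less[where N=k0 and B="2 * \<rho> * deg i" and v="\<lambda>k. v k i"] v_mono v_upper k0) auto
  moreover have "eventually (\<lambda>k. k \<ge> k0) sequentially" by (rule eventually_ge_at_top)
  ultimately have "eventually (\<lambda>k. q (Suc k) j = -1) sequentially"
  proof eventually_elim
    case (elim k)
    then show ?case using v_jump[of k i j] k0[of "Suc k"] assms(2) q_cases[of "Suc k" j] by fastforce
  qed
  then show ?thesis by (simp add: eventually_sequentially_Suc[where P="\<lambda>k. q k j = -1"])
qed

lemma eventually_neg_rtrancl:
  assumes "E\<^sup>*\<^sup>* i j" "eventually (\<lambda>k. q k i = -1) sequentially"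
  shows "eventually (\<lambda>k. q k j = -1) sequentially"
  using assms by (induction) (auto intro: eventually_neg_nbr)

text \<open>A node that never reaches 1 would drag the whole connected graph to -1. Hence every node
  visits 1, and \<open>v_lower\<close> bounds each summand of the conserved total.\<close>

lemma not_converges_neg:
  assumes "\<not> converges_at n E (quant (-1) 2 1) \<rho> r (-1)"
  shows "(\<Sum>i<n. r i) \<ge> - 4 * \<rho> * (real n)\<^sup>2"
proof -
  have "\<exists>k. q (Suc k) i = 1" if "i < n" for i
  proof (rule ccontr)
    assume "\<nexists>k. q (Suc k) i = 1"
    then have "eventually (\<lambda>k. q (Suc k) i = -1) sequentially"
      using q_cases by (auto intro!: always_eventually)
    then have "eventually (\<lambda>k. q k i = -1) sequentially"
      by (simp add: eventually_sequentially_Suc[where P="\<lambda>k. q k i = -1"])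
    then have "\<forall>j\<in>{..<n}. eventually (\<lambda>k. q k j = -1) sequentially"
      using connected that by (auto intro: eventually_neg_rtrancl simp: connected_graph_def)
    then have "eventually (\<lambda>k. \<forall>j\<in>{..<n}. q k j = -1) sequentially"
      by (simp add: eventually_ball_finite)
    then show False using assms by (auto simp: converges_at_def q_def eventually_sequentially)
  qed
  then obtain t where t: "\<And>i. i < n \<Longrightarrow> q (Suc (t i)) i = 1" by metis
  \<comment> \<open>The sum of the hitting times is one time that is past none too early: it
    dominates each of them.\<close>
  define l where "l = (\<Sum>i<n. Suc (t i))"
  have "- (4 * \<rho> * n) \<le> v l i" if "i < n" for i
  proof -
    have "Suc (t i) \<le> l" unfolding l_def using that by (intro member_le_sum) auto
    then have "- (4 * \<rho> * deg i) \<le> v l i" using t[OF that] by (intro v_lower)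
    moreover have "4 * \<rho> * deg i \<le> 4 * \<rho> * n" using deg_le \<rho>_pos by (intro mult_left_mono) auto
    ultimately show ?thesis by linarith
  qed
  then have "(\<Sum>i<n. - (4 * \<rho> * n)) \<le> (\<Sum>i<n. v l i)" by (intro sum_mono) auto
  then show ?thesis by (simp add: sum_v power2_eq_square algebra_simps)
qed

text \<open>A single time with all nodes at -1 suffices: \<open>v_upper\<close> bounds every summand
  of the conserved total one step before.\<close>

lemma converges_neg:
  assumes "converges_at n E (quant (-1) 2 1) \<rho> r (-1)"
  shows "(\<Sum>i<n. r i) \<le> 2 * \<rho> * (real n)\<^sup>2"
proof -
  obtain k where k: "\<And>i. i < n \<Longrightarrow> q (Suc k) i = -1"
    using assms unfolding converges_at_def q_def by (meson le_Suc_eq order_refl)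
  have "v k i \<le> 2 * \<rho> * n" if "i < n" for i
  proof -
    have "2 * \<rho> * deg i \<le> 2 * \<rho> * n" using deg_le \<rho>_pos by (intro mult_left_mono) auto
    then show ?thesis using v_upper[OF k[OF that]] by linarith
  qed
  then have "(\<Sum>i<n. v k i) \<le> (\<Sum>i<n. 2 * \<rho> * n)" by (intro sum_mono) auto
  then show ?thesis by (simp add: sum_v power2_eq_square algebra_simps)
qed

end

section \<open>Measurability of the algorithm's verdict\<close>

text \<open>Neighbours have index below \<open>n\<close>, so the induction stays within the
  coordinates where \<open>r\<close> is assumed measurable.\<close>

lemma bqcadmm_measurable:
  assumes r: "\<And>i. i < n \<Longrightarrow> (\<lambda>y. r y i) \<in> borel_measurable M"
    and Q [measurable]: "Q \<in> borel_measurable borel" and "i < n"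
  shows "(\<lambda>y. fst (bqcadmm n E Q \<rho> (r y) k) i) \<in> borel_measurable M"
    and "(\<lambda>y. snd (bqcadmm n E Q \<rho> (r y) k) i) \<in> borel_measurable M"
  using \<open>i < n\<close>
proof (induction k arbitrary: i)
  case (Suc k)
  have nb: "j < n" if "j \<in> nbrs n E i" for i j using that by (simp add: nbrs_def)
  note [measurable] = Suc.IH r
  \<comment> \<open>The new \<open>x\<close> comes first because the update of \<alpha> quantizes
    it.\<close>
  have [measurable]: "(\<lambda>y. fst (bqcadmm n E Q \<rho> (r y) (Suc k)) i) \<in> borel_measurable M"
    if "i < n" for i
    using that by (auto simp: Let_def nb)
  {
    case 1
    then show ?case by measurable
  next
    case 2
    have "(\<lambda>y. snd (bqcadmm n E Q \<rho> (r y) k) i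
        + \<rho> * (real (card (nbrs n E i)) * Q (fst (bqcadmm n E Q \<rho> (r y) (Suc k)) i)
          - (\<Sum>j\<in>nbrs n E i. Q (fst (bqcadmm n E Q \<rho> (r y) (Suc k)) j)))) \<in> borel_measurable M"
      using 2 by (auto simp del: bqcadmm.simps simp: nb)
    then show ?case by (simp add: Let_def)
  }
qed simp_all

lemma converges_at_measurable:
  assumes "\<And>i. i < n \<Longrightarrow> (\<lambda>y. r y i) \<in> borel_measurable M"
    and Q [measurable]: "Q \<in> borel_measurable borel"
  shows "Measurable.pred M (\<lambda>y. converges_at n E Q \<rho> (r y) c)"
proof -
  note [measurable] = bqcadmm_measurable(1)[OF assms]
  have "Measurable.pred M (\<lambda>y. \<forall>i\<in>{..<n}. Q (fst (bqcadmm n E Q \<rho> (r y) k) i) = c)" for k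
    by measurable
  then have [measurable]: "Measurable.pred M (\<lambda>y. \<forall>i<n. Q (fst (bqcadmm n E Q \<rho> (r y) k) i) = c)" for k
    by (simp add: Ball_def)
  show ?thesis unfolding converges_at_def by measurable
qed

subsection \<open>Exponential moments and product densities\<close>

text \<open>The key is \<open>exp u - 1 \<le> u * exp u\<close>, which is
  \<open>1 - u \<le> exp (- u)\<close> multiplied by \<open>exp u\<close>. The explicit remainder
  can be integrated.\<close>

lemma exp_le_quadratic: "exp u \<le> 1 + u + u\<^sup>2 * exp \<bar>u\<bar>" for u :: real
proof -
  have "1 - u \<le> exp (- u)" using exp_ge_add_one_self[of "- u"] by simp
  then have "(1 - u) * exp u \<le> exp (- u) * exp u" by (intro mult_right_mono) auto
  then have *: "exp u - 1 \<le> u * exp u" by (simp add: algebra_simps flip: exp_add)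
  show ?thesis
  proof (cases "u \<ge> 0")
    case True
    then have "u * (exp u - 1) \<le> u * (u * exp u)" using * by (intro mult_left_mono)
    with * True show ?thesis by (simp add: power2_eq_square algebra_simps)
  next
    case False
    then have "u * exp u \<le> u * (1 + u)"
      using exp_ge_add_one_self[of u] by (intro mult_left_mono_neg) auto
    moreover have "u\<^sup>2 * 1 \<le> u\<^sup>2 * exp \<bar>u\<bar>" by (intro mult_left_mono) auto
    moreover have "u * (1 + u) = u + u\<^sup>2 * 1" by (simp add: power2_eq_square algebra_simps)
    ultimately show ?thesis using * by linarith
  qed
qed

lemma exp_abs_le: "exp \<bar>u\<bar> \<le> exp u + exp (- u)" for u :: real
  by (cases "u \<ge> 0") auto

text \<open>If \<open>h = 0\<close> minimises the moment generating function near \<open>0\<close>, its derivative there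
  vanishes; the right-hand side below grows linearly in \<open>h\<close>, so it wins for small \<open>h\<close>.\<close>

lemma (in prob_space) exp_moment_less:
  fixes f :: "'a \<Rightarrow> real"
  assumes [measurable]: "f \<in> borel_measurable M" and "a > 0" "\<epsilon> > 0"
    and int: "\<And>h. \<bar>h\<bar> \<le> a \<Longrightarrow> integrable M (\<lambda>x. exp (h * f x))"
    and min: "\<And>h. \<bar>h\<bar> \<le> a \<Longrightarrow> 1 \<le> (\<integral>x. exp (h * f x) \<partial>M)"
  obtains h where "0 < h" "h \<le> a" "(\<integral>x. exp (h * f x) \<partial>M) < exp (h * \<epsilon>)"
proof -
  \<comment> \<open>Half of the radius is kept for the exponential in \<open>g\<close>; the other
    half absorbs the square of \<open>f\<close>.\<close>
  define h1 where "h1 = a / 2"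
  have h1: "h1 > 0" "h1 \<le> a" using \<open>a > 0\<close> by (auto simp: h1_def)
  define g where "g x = (f x)\<^sup>2 * exp (h1 * \<bar>f x\<bar>)" for x
  have [measurable]: "g \<in> borel_measurable M" unfolding g_def by measurable
  have dom: "integrable M (\<lambda>x. exp (a * f x) + exp (- a * f x))"
    using int[of a] int[of "- a"] \<open>a > 0\<close> by auto
  have domle: "exp (a * \<bar>y\<bar>) \<le> exp (a * y) + exp (- a * y)" for y
    using exp_abs_le[of "a * y"] \<open>a > 0\<close> by (simp add: abs_mult)
  have g_int: "integrable M g"
  proof (rule Bochner_Integration.integrable_bound)
    show "integrable M (\<lambda>x. 2 / h1\<^sup>2 * (exp (a * f x) + exp (- a * f x)))" by (intro integrable_mult_right dom)
    have "(f x)\<^sup>2 * exp (h1 * \<bar>f x\<bar>) \<le> 2 / h1\<^sup>2 * (exp (a * f x) + exp (- a * f x))" for x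
    proof -
      have "(h1 * \<bar>f x\<bar>)\<^sup>2 / 2 \<le> exp (h1 * \<bar>f x\<bar>)"
        using exp_lower_Taylor_quadratic[of "h1 * \<bar>f x\<bar>"] h1 by (smt (verit) mult_nonneg_nonneg abs_ge_zero)
      then have "(f x)\<^sup>2 \<le> 2 / h1\<^sup>2 * exp (h1 * \<bar>f x\<bar>)" using h1 by (simp add: field_simps)
      then have "(f x)\<^sup>2 * exp (h1 * \<bar>f x\<bar>) \<le> 2 / h1\<^sup>2 * exp (h1 * \<bar>f x\<bar>) * exp (h1 * \<bar>f x\<bar>)"
        by (intro mult_right_mono) auto
      also have "\<dots> = 2 / h1\<^sup>2 * exp (a * \<bar>f x\<bar>)" by (simp add: h1_def flip: exp_add)
      also have "\<dots> \<le> 2 / h1\<^sup>2 * (exp (a * f x) + exp (- a * f x))"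
        by (intro mult_left_mono domle) auto
      finally show ?thesis .
    qed
    then show "AE x in M. norm (g x) \<le> norm (2 / h1\<^sup>2 * (exp (a * f x) + exp (- a * f x)))"
      by (intro AE_I2) (auto simp: g_def intro: order_trans)
  qed simp
  have f_int: "integrable M f"
  proof (rule Bochner_Integration.integrable_bound)
    show "integrable M (\<lambda>x. 1 / a * (exp (a * f x) + exp (- a * f x)))" by (intro integrable_mult_right dom)
    have "\<bar>f x\<bar> \<le> 1 / a * (exp (a * f x) + exp (- a * f x))" for x
    proof -
      have "a * \<bar>f x\<bar> \<le> exp (a * \<bar>f x\<bar>)" using exp_ge_add_one_self[of "a * \<bar>f x\<bar>"] by linarith
      also note domle
      finally show ?thesis using \<open>a > 0\<close> by (simp add: field_simps)
    qed
    then show "AE x in M. norm (f x) \<le> norm (1 / a * (exp (a * f x) + exp (- a * f x)))"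
      using \<open>a > 0\<close> by (intro AE_I2) auto
  qed simp
  define m where "m = (\<integral>x. f x \<partial>M)"
  define G where "G = (\<integral>x. g x \<partial>M)"
  have "G \<ge> 0" unfolding G_def g_def by (intro integral_nonneg_AE) auto
  \<comment> \<open>A second-order upper bound, uniform in \<open>h\<close>, that replaces
    differentiation under the integral.\<close>
  have quad: "(\<integral>x. exp (h * f x) \<partial>M) \<le> 1 + h * m + h\<^sup>2 * G" if "\<bar>h\<bar> \<le> h1" for h
  proof -
    have "(\<integral>x. exp (h * f x) \<partial>M) \<le> (\<integral>x. 1 + h * f x + h\<^sup>2 * g x \<partial>M)"
    proof (intro integral_mono int)
      fix x
      have "exp (h * f x) \<le> 1 + h * f x + (h * f x)\<^sup>2 * exp \<bar>h * f x\<bar>" by (rule exp_le_quadratic)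
      also have "\<dots> \<le> 1 + h * f x + (h * f x)\<^sup>2 * exp (h1 * \<bar>f x\<bar>)"
        using that by (intro add_left_mono mult_left_mono) (auto simp: abs_mult intro: mult_right_mono)
      finally show "exp (h * f x) \<le> 1 + h * f x + h\<^sup>2 * g x" by (simp add: g_def power_mult_distrib)
    qed (use that h1 f_int g_int in auto)
    also have "\<dots> = 1 + h * m + h\<^sup>2 * G"
      using f_int g_int by (simp add: m_def G_def prob_space)
    finally show ?thesis .
  qed
  \<comment> \<open>Small enough for \<open>2 * t * G < \<epsilon>\<close>; the \<open>+ 1\<close>
    makes this strict and avoids dividing by 0.\<close>
  define t where "t = min h1 (\<epsilon> / (2 * (G + 1)))"
  have t: "t > 0" "t \<le> h1" using h1 \<open>G \<ge> 0\<close> \<open>\<epsilon> > 0\<close> by (auto simp: t_def)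
  have "t * (2 * (G + 1)) \<le> \<epsilon>"
    using \<open>G \<ge> 0\<close> unfolding t_def by (subst pos_le_divide_eq[symmetric]) auto
  then have tG: "2 * t * G < \<epsilon>" using t by (simp add: algebra_simps)
  \<comment> \<open>Minimality at the negative point \<open>- t\<close> bounds the mean
    \<open>m\<close> from above.\<close>
  have "1 \<le> 1 + (- t) * m + (- t)\<^sup>2 * G"
    using t h1 by (intro order_trans[OF min quad]) auto
  then have "t * m \<le> t * (t * G)" by (simp add: power2_eq_square)
  then have "m \<le> t * G" using t by simp
  have "(\<integral>x. exp (t * f x) \<partial>M) \<le> 1 + t * m + t\<^sup>2 * G" using quad[of t] t by auto
  also have "\<dots> = 1 + t * (m + t * G)" by (simp add: power2_eq_square algebra_simps)
  also have "\<dots> < 1 + t * \<epsilon>" using t tG \<open>m \<le> t * G\<close> by simp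
  also have "\<dots> \<le> exp (t * \<epsilon>)" by (rule exp_ge_add_one_self)
  finally show ?thesis using that[of t] t h1 by simp
qed

text \<open>Markov's inequality for the exponential of \<open>h\<close> times the sum, whose
  expectation factorises over the independent coordinates.\<close>

lemma (in prob_space) PiM_Chernoff_bound:
  fixes f :: "'a \<Rightarrow> real"
  assumes [measurable]: "f \<in> borel_measurable M" and "h > 0"
    and int: "integrable M (\<lambda>x. exp (h * f x))"
  shows "measure (PiM {..<n} (\<lambda>_. M)) {y \<in> space (PiM {..<n} (\<lambda>_. M)). real n * \<epsilon> \<le> (\<Sum>i<n. f (y i))}
    \<le> ((\<integral>x. exp (h * f x) \<partial>M) / exp (h * \<epsilon>)) ^ n"
proof -
  interpret P: product_sigma_finite "\<lambda>_::nat. M" by unfold_locales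
  let ?u = "\<lambda>y. \<Prod>i<n. exp (h * f (y i))"
  have eq: "?u y = exp (h * (\<Sum>i<n. f (y i)))" for y :: "nat \<Rightarrow> 'a"
    by (simp add: exp_sum sum_distrib_left)
  have "n * \<epsilon> \<le> (\<Sum>i<n. f (y i)) \<longleftrightarrow> exp (h * \<epsilon>) ^ n \<le> ?u y" for y :: "nat \<Rightarrow> 'a"
    unfolding eq using \<open>h > 0\<close> by (simp add: algebra_simps flip: exp_of_nat_mult)
  then have "measure (PiM {..<n} (\<lambda>_. M)) {y \<in> space (PiM {..<n} (\<lambda>_. M)). real n * \<epsilon> \<le> (\<Sum>i<n. f (y i))}
    = measure (PiM {..<n} (\<lambda>_. M)) {y \<in> space (PiM {..<n} (\<lambda>_. M)). exp (h * \<epsilon>) ^ n \<le> ?u y}" by simp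
  also have "\<dots> \<le> (\<integral>y. ?u y \<partial>PiM {..<n} (\<lambda>_. M)) / exp (h * \<epsilon>) ^ n"
    by (rule integral_Markov_inequality_measure[where A="{}"])
      (auto intro!: P.product_integrable_prod int prod_nonneg)
  also have "(\<integral>y. ?u y \<partial>PiM {..<n} (\<lambda>_. M)) = (\<integral>x. exp (h * f x) \<partial>M) ^ n"
    by (subst P.product_integral_prod) (auto intro: int)
  finally show ?thesis by (simp add: power_divide)
qed

text \<open>Both tails decay geometrically. Minimality of the moment generating function at 0 stands
  in for a zero mean.\<close>

lemma (in prob_space) weak_law_exp_moment:
  fixes f :: "'a \<Rightarrow> real"
  assumes [measurable]: "f \<in> borel_measurable M" and "a > 0" "\<epsilon> > 0"
    and int: "\<And>h. \<bar>h\<bar> \<le> a \<Longrightarrow> integrable M (\<lambda>x. exp (h * f x))"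
    and min: "\<And>h. \<bar>h\<bar> \<le> a \<Longrightarrow> 1 \<le> (\<integral>x. exp (h * f x) \<partial>M)"
  shows "(\<lambda>n. measure (PiM {..<n} (\<lambda>_. M))
    {y \<in> space (PiM {..<n} (\<lambda>_. M)). \<bar>\<Sum>i<n. f (y i)\<bar> \<le> real n * \<epsilon>}) \<longlonglongrightarrow> 1"
proof -
  let ?P = "\<lambda>n. PiM {..<n} (\<lambda>_. M)"
  let ?tail = "\<lambda>g n. {y \<in> space (?P n). real n * \<epsilon> \<le> (\<Sum>i<n. g (y i))}"
  \<comment> \<open>Stated for general \<open>g\<close>: the hypotheses are symmetric in
    \<open>h\<close>, so they pass from \<open>f\<close> to \<open>- f\<close>.\<close>
  have tail: "(\<lambda>n. measure (?P n) (?tail g n)) \<longlonglongrightarrow> 0"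
    if gm [measurable]: "g \<in> borel_measurable M"
      and g: "\<And>h. \<bar>h\<bar> \<le> a \<Longrightarrow> integrable M (\<lambda>x. exp (h * g x))"
        "\<And>h. \<bar>h\<bar> \<le> a \<Longrightarrow> 1 \<le> (\<integral>x. exp (h * g x) \<partial>M)" for g
  proof -
    obtain h where h: "0 < h" "h \<le> a" "(\<integral>x. exp (h * g x) \<partial>M) < exp (h * \<epsilon>)"
      using exp_moment_less[OF gm \<open>a > 0\<close> \<open>\<epsilon> > 0\<close> g] by blast
    let ?c = "(\<integral>x. exp (h * g x) \<partial>M) / exp (h * \<epsilon>)"
    have "0 \<le> ?c" "?c < 1" using h by (auto intro!: divide_nonneg_pos integral_nonneg_AE)
    then have "(\<lambda>n. ?c ^ n) \<longlonglongrightarrow> 0" by (intro LIMSEQ_power_zero) auto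
    then show ?thesis
    proof (rule tendsto_sandwich[OF _ _ tendsto_const, rotated 2])
      have "measure (?P n) (?tail g n) \<le> ?c ^ n" for n
        using h g(1)[of h] by (intro PiM_Chernoff_bound) auto
      then show "eventually (\<lambda>n. measure (?P n) (?tail g n) \<le> ?c ^ n) sequentially" by simp
    qed simp
  qed
  let ?W = "\<lambda>n. {y \<in> space (?P n). \<bar>\<Sum>i<n. f (y i)\<bar> \<le> real n * \<epsilon>}"
  have pos: "(\<lambda>n. measure (?P n) (?tail f n)) \<longlonglongrightarrow> 0" by (intro tail int min) simp_all
  have neg: "(\<lambda>n. measure (?P n) (?tail (\<lambda>x. - f x) n)) \<longlonglongrightarrow> 0"
  proof (rule tail)
    fix h assume "\<bar>h\<bar> \<le> a"
    then show "integrable M (\<lambda>x. exp (h * - f x))" "1 \<le> (\<integral>x. exp (h * - f x) \<partial>M)"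
      using int[of "- h"] min[of "- h"] by simp_all
  qed simp
  have lower: "1 - (measure (?P n) (?tail f n) + measure (?P n) (?tail (\<lambda>x. - f x) n)) \<le> measure (?P n) (?W n)" for n
  proof -
    interpret P: prob_space "?P n" by (intro prob_space_PiM prob_space_axioms)
    have "1 - P.prob (?W n) = P.prob (space (?P n) - ?W n)" by (subst P.prob_compl) auto
    also have "\<dots> \<le> P.prob (?tail f n \<union> ?tail (\<lambda>x. - f x) n)"
      by (intro P.finite_measure_mono) (auto simp: sum_negf)
    also have "\<dots> \<le> P.prob (?tail f n) + P.prob (?tail (\<lambda>x. - f x) n)"
      by (intro measure_Un_le) auto
    finally show ?thesis by simp
  qed
  define w b where "w n = measure (?P n) (?W n)"
    and "b n = 1 - (measure (?P n) (?tail f n) + measure (?P n) (?tail (\<lambda>x. - f x) n))" for n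
  have "b \<longlonglongrightarrow> 1 - (0 + 0)"
    unfolding b_def by (intro tendsto_diff tendsto_add tendsto_const pos neg)
  then have lim: "b \<longlonglongrightarrow> 1" by simp
  have "b n \<le> w n" for n unfolding b_def w_def by (rule lower)
  moreover have "w n \<le> 1" for n
    unfolding w_def by (intro prob_space.prob_le_1 prob_space_PiM prob_space_axioms)
  ultimately have "w \<longlonglongrightarrow> 1"
    by (intro tendsto_sandwich[OF _ _ lim tendsto_const]) auto
  then show ?thesis unfolding w_def .
qed

section \<open>Densities of finite products\<close>

text \<open>A finite product measure is determined by its values on boxes, where the integral of the
  product density factorises.\<close>

lemma PiM_density:
  fixes g :: "'a \<Rightarrow> ennreal"
  assumes "finite I" "prob_space N" "prob_space (density N g)"
    and [measurable]: "g \<in> borel_measurable N"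
  shows "PiM I (\<lambda>_. density N g) = density (PiM I (\<lambda>_. N)) (\<lambda>y. \<Prod>i\<in>I. g (y i))"
proof -
  interpret N: prob_space N by fact
  interpret D: prob_space "density N g" by fact
  interpret PN: product_sigma_finite "\<lambda>_. N" by unfold_locales
  interpret PD: product_sigma_finite "\<lambda>_. density N g" by unfold_locales
  show ?thesis
  proof (rule PD.PiM_eqI[OF \<open>finite I\<close>, symmetric])
    show "sets (density (PiM I (\<lambda>_. N)) (\<lambda>y. \<Prod>i\<in>I. g (y i))) = sets (PiM I (\<lambda>_. density N g))"
      by (simp cong: sets_PiM_cong)
    fix A assume A: "\<And>i. i \<in> I \<Longrightarrow> A i \<in> sets (density N g)"
    then have [measurable]: "\<And>i. i \<in> I \<Longrightarrow> A i \<in> sets N" by simp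
    have [measurable]: "Pi\<^sub>E I A \<in> sets (PiM I (\<lambda>_. N))"
      using \<open>finite I\<close> A by (intro sets_PiM_I_finite) auto
    have "emeasure (density (PiM I (\<lambda>_. N)) (\<lambda>y. \<Prod>i\<in>I. g (y i))) (Pi\<^sub>E I A)
      = (\<integral>\<^sup>+y. (\<Prod>i\<in>I. g (y i)) * indicator (Pi\<^sub>E I A) y \<partial>PiM I (\<lambda>_. N))"
      by (subst emeasure_density) auto
    also have "\<dots> = (\<integral>\<^sup>+y. (\<Prod>i\<in>I. g (y i) * indicator (A i) (y i)) \<partial>PiM I (\<lambda>_. N))"
    proof (intro nn_integral_cong)
      fix y assume y: "y \<in> space (PiM I (\<lambda>_. N))"
      have "indicator (Pi\<^sub>E I A) y = (\<Prod>i\<in>I. indicator (A i) (y i) :: ennreal)"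
        using y \<open>finite I\<close> by (auto simp: indicator_def space_PiM PiE_iff)
      then show "(\<Prod>i\<in>I. g (y i)) * indicator (Pi\<^sub>E I A) y = (\<Prod>i\<in>I. g (y i) * indicator (A i) (y i))"
        by (simp add: prod.distrib)
    qed
    also have "\<dots> = (\<Prod>i\<in>I. \<integral>\<^sup>+x. g x * indicator (A i) x \<partial>N)"
      using \<open>finite I\<close> by (intro PN.product_nn_integral_prod) auto
    also have "\<dots> = (\<Prod>i\<in>I. emeasure (density N g) (A i))"
      by (intro prod.cong) (auto simp: emeasure_density)
    finally show "emeasure (density (PiM I (\<lambda>_. N)) (\<lambda>y. \<Prod>i\<in>I. g (y i))) (Pi\<^sub>E I A)
      = (\<Prod>i\<in>I. emeasure (density N g) (A i))" .
  qed
qed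

lemma measure_density_le:
  fixes g :: "'a \<Rightarrow> real"
  assumes "finite_measure N" and [measurable]: "g \<in> borel_measurable N" "A \<in> sets N"
    and "c \<ge> 0" "\<And>x. x \<in> A \<Longrightarrow> g x \<le> c"
  shows "measure (density N (\<lambda>x. ennreal (g x))) A \<le> c * measure N A"
proof -
  interpret N: finite_measure N by fact
  have "emeasure (density N (\<lambda>x. ennreal (g x))) A = (\<integral>\<^sup>+x. ennreal (g x) * indicator A x \<partial>N)"
    by (simp add: emeasure_density)
  also have "\<dots> \<le> (\<integral>\<^sup>+x. ennreal c * indicator A x \<partial>N)"
    using assms(5) by (intro nn_integral_mono) (auto simp: indicator_def ennreal_leI)
  also have "\<dots> = ennreal (c * measure N A)"
    using \<open>c \<ge> 0\<close> by (simp add: nn_integral_cmult N.emeasure_eq_measure ennreal_mult)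
  finally show ?thesis
    using \<open>c \<ge> 0\<close> by (simp add: measure_def enn2real_leI)
qed

lemma measure_density_ge:
  fixes g :: "'a \<Rightarrow> real"
  assumes "finite_measure N" "finite_measure (density N (\<lambda>x. ennreal (g x)))"
    and [measurable]: "g \<in> borel_measurable N" "A \<in> sets N"
    and "c \<ge> 0" "\<And>x. x \<in> A \<Longrightarrow> c \<le> g x"
  shows "c * measure N A \<le> measure (density N (\<lambda>x. ennreal (g x))) A"
proof -
  interpret N: finite_measure N by fact
  interpret D: finite_measure "density N (\<lambda>x. ennreal (g x))" by fact
  have "ennreal (c * measure N A) = (\<integral>\<^sup>+x. ennreal c * indicator A x \<partial>N)"
    using \<open>c \<ge> 0\<close> by (simp add: nn_integral_cmult N.emeasure_eq_measure ennreal_mult)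
  also have "\<dots> \<le> (\<integral>\<^sup>+x. ennreal (g x) * indicator A x \<partial>N)"
    using assms(6) by (intro nn_integral_mono) (auto simp: indicator_def ennreal_leI)
  also have "\<dots> = emeasure (density N (\<lambda>x. ennreal (g x))) A"
    by (simp add: emeasure_density)
  also have "\<dots> = ennreal (measure (density N (\<lambda>x. ennreal (g x))) A)"
    by (rule D.emeasure_eq_measure)
  finally show ?thesis by simp
qed

subsection \<open>Error exponent of tests close to the likelihood ratio test\<close>

lemma PiM_density_exp:
  fixes f :: "'a \<Rightarrow> real"
  assumes T: "prob_space T" and D: "prob_space (density T (\<lambda>x. ennreal (c * exp (b * f x))))"
    and [measurable]: "f \<in> borel_measurable T" and "c \<ge> 0"
  shows "PiM {..<n} (\<lambda>_. density T (\<lambda>x. ennreal (c * exp (b * f x)))) =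
    density (PiM {..<n} (\<lambda>_. T)) (\<lambda>y. ennreal (c ^ n * exp (b * (\<Sum>i<n. f (y i)))))"
proof -
  have "(\<Prod>i<n. ennreal (c * exp (b * f (y i)))) = ennreal (c ^ n * exp (b * (\<Sum>i<n. f (y i))))"
    for y :: "nat \<Rightarrow> 'a"
    using \<open>c \<ge> 0\<close> by (subst prod_ennreal) (auto simp: prod.distrib sum_distrib_left exp_sum)
  then show ?thesis by (subst PiM_density[OF _ T D]) auto
qed

text \<open>Both hypotheses are written relative to one tilted measure. Their density ratio is
  \<open>exp (f x)\<close>, so \<open>f\<close> is the log-likelihood ratio; \<open>c\<close> will
  be the minimal Chernoff integral.\<close>

locale tilted_pair = prob_space T for T :: "'a measure" +
  fixes f :: "'a \<Rightarrow> real" and l c :: real and P1 P2 :: "'a measure"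
  assumes f_measurable [measurable]: "f \<in> borel_measurable T"
    and l: "0 \<le> l" "l \<le> 1" and c: "0 < c"
    and P1: "P1 = density T (\<lambda>x. ennreal (c * exp ((1 - l) * f x)))" "prob_space P1"
    and P2: "P2 = density T (\<lambda>x. ennreal (c * exp (- l * f x)))" "prob_space P2"
begin

definition S :: "nat \<Rightarrow> (nat \<Rightarrow> 'a) \<Rightarrow> real" where "S n y = (\<Sum>i<n. f (y i))"

abbreviation Tn :: "nat \<Rightarrow> (nat \<Rightarrow> 'a) measure" where "Tn n \<equiv> PiM {..<n} (\<lambda>_. T)"

lemma S_measurable [measurable]: "S n \<in> borel_measurable (Tn n)"
  unfolding S_def by measurable

lemma PiM_P1: "PiM {..<n} (\<lambda>_. P1) = density (Tn n) (\<lambda>y. ennreal (c ^ n * exp ((1 - l) * S n y)))"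
  unfolding P1(1) S_def
  using P1(2) c by (intro PiM_density_exp prob_space_axioms f_measurable) (simp_all add: P1(1))

lemma PiM_P2: "PiM {..<n} (\<lambda>_. P2) = density (Tn n) (\<lambda>y. ennreal (c ^ n * exp (- l * S n y)))"
  unfolding P2(1) S_def
  using P2(2) c by (intro PiM_density_exp prob_space_axioms f_measurable) (simp_all add: P2(1))

lemma prob_space_Tn: "prob_space (Tn n)"
  by (intro prob_space_PiM prob_space_axioms)

lemma sets_PiM_Pi: "sets (PiM {..<n} (\<lambda>_. P1)) = sets (Tn n)" "sets (PiM {..<n} (\<lambda>_. P2)) = sets (Tn n)"
  by (auto simp: P1(1) P2(1) cong: sets_PiM_cong)

lemma measure_le:
  assumes A: "A \<in> sets (Tn n)" and "\<And>y. y \<in> A \<Longrightarrow> b * S n y \<le> 1"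
  shows "measure (density (Tn n) (\<lambda>y. ennreal (c ^ n * exp (b * S n y)))) A
    \<le> exp 1 * c ^ n * measure (Tn n) A"
proof -
  interpret Tn: prob_space "Tn n" by (rule prob_space_Tn)
  show ?thesis
    using assms c by (intro measure_density_le) (auto simp: mult.commute Tn.finite_measure_axioms)
qed

text \<open>Each density is at most \<open>exp 1 * c ^ n\<close> on its own error region. The two
  regions partition the space, so their masses under \<open>Tn n\<close> add up to 1.\<close>

lemma error_upper_bound:
  assumes A: "A \<in> sets (Tn n)" and prior: "\<pi>1 > 0" "\<pi>2 > 0" "\<pi>1 + \<pi>2 = 1"
    and S: "\<And>y. y \<in> A \<Longrightarrow> -1 \<le> S n y" "\<And>y. y \<in> space (Tn n) - A \<Longrightarrow> S n y \<le> 1"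
  shows "\<pi>1 * measure (PiM {..<n} (\<lambda>_. P1)) (space (Tn n) - A) + \<pi>2 * measure (PiM {..<n} (\<lambda>_. P2)) A
    \<le> exp 1 * c ^ n"
proof -
  interpret Tn: prob_space "Tn n" by (rule prob_space_Tn)
  have "(1 - l) * S n y \<le> 1" if "y \<in> space (Tn n) - A" for y
    using mult_left_mono[OF S(2)[OF that], of "1 - l"] l by simp
  then have 1: "measure (PiM {..<n} (\<lambda>_. P1)) (space (Tn n) - A) \<le> exp 1 * c ^ n * Tn.prob (space (Tn n) - A)"
    unfolding PiM_P1 using A by (intro measure_le) auto
  have "- l * S n y \<le> 1" if "y \<in> A" for y
    using mult_left_mono[OF S(1)[OF that], of l] l by simp
  then have 2: "measure (PiM {..<n} (\<lambda>_. P2)) A \<le> exp 1 * c ^ n * Tn.prob A"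
    unfolding PiM_P2 using A by (intro measure_le) auto
  have "\<pi>1 * measure (PiM {..<n} (\<lambda>_. P1)) (space (Tn n) - A) + \<pi>2 * measure (PiM {..<n} (\<lambda>_. P2)) A
    \<le> 1 * measure (PiM {..<n} (\<lambda>_. P1)) (space (Tn n) - A) + 1 * measure (PiM {..<n} (\<lambda>_. P2)) A"
    using prior by (intro add_mono mult_right_mono) auto
  also have "\<dots> \<le> exp 1 * c ^ n * Tn.prob (space (Tn n) - A) + exp 1 * c ^ n * Tn.prob A"
    using 1 2 by simp
  also have "\<dots> = exp 1 * c ^ n" using A by (simp add: Tn.prob_compl algebra_simps)
  finally show ?thesis .
qed

lemma measure_ge:
  assumes [measurable]: "A \<in> sets (Tn n)" and b: "\<bar>b\<bar> \<le> 1" and "0 \<le> \<epsilon>"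
    and D: "prob_space (density (Tn n) (\<lambda>y. ennreal (c ^ n * exp (b * S n y))))"
  shows "c ^ n * exp (- (n * \<epsilon>)) * measure (Tn n) (A \<inter> {y \<in> space (Tn n). \<bar>S n y\<bar> \<le> n * \<epsilon>})
    \<le> measure (density (Tn n) (\<lambda>y. ennreal (c ^ n * exp (b * S n y)))) A"
proof -
  interpret Tn: prob_space "Tn n" by (rule prob_space_Tn)
  interpret D: prob_space "density (Tn n) (\<lambda>y. ennreal (c ^ n * exp (b * S n y)))" by (rule D)
  let ?W = "{y \<in> space (Tn n). \<bar>S n y\<bar> \<le> n * \<epsilon>}"
  have "- (n * \<epsilon>) \<le> b * S n y" if "y \<in> ?W" for y
  proof -
    have "\<bar>b * S n y\<bar> \<le> 1 * (n * \<epsilon>)" unfolding abs_mult using that b by (intro mult_mono) auto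
    then show ?thesis by simp
  qed
  then have "c ^ n * exp (- (n * \<epsilon>)) * Tn.prob (A \<inter> ?W) \<le> D.prob (A \<inter> ?W)"
    using c by (intro measure_density_ge Tn.finite_measure_axioms D.finite_measure_axioms) auto
  also have "\<dots> \<le> D.prob A" by (intro D.finite_measure_mono) auto
  finally show ?thesis .
qed

text \<open>This holds for any test: however \<open>A\<close> splits the set of small \<bar>S\<bar>,
  each piece is charged to one of the two errors, and \<open>measure_ge\<close> bounds both
  densities there.\<close>

lemma error_lower_bound:
  assumes A [measurable]: "A \<in> sets (Tn n)" and prior: "\<pi>1 > 0" "\<pi>2 > 0" and "0 \<le> \<epsilon>"
  shows "min \<pi>1 \<pi>2 * c ^ n * exp (- (n * \<epsilon>)) * measure (Tn n) {y \<in> space (Tn n). \<bar>S n y\<bar> \<le> n * \<epsilon>}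
    \<le> \<pi>1 * measure (PiM {..<n} (\<lambda>_. P1)) (space (Tn n) - A) + \<pi>2 * measure (PiM {..<n} (\<lambda>_. P2)) A"
proof -
  interpret Tn: prob_space "Tn n" by (rule prob_space_Tn)
  let ?W = "{y \<in> space (Tn n). \<bar>S n y\<bar> \<le> n * \<epsilon>}"
  let ?k = "c ^ n * exp (- (n * \<epsilon>))"
  have D1: "prob_space (PiM {..<n} (\<lambda>_. P1))" and D2: "prob_space (PiM {..<n} (\<lambda>_. P2))"
    using P1(2) P2(2) by (auto intro: prob_space_PiM)
  have 1: "?k * Tn.prob ((space (Tn n) - A) \<inter> ?W) \<le> measure (PiM {..<n} (\<lambda>_. P1)) (space (Tn n) - A)"
    using D1 l \<open>0 \<le> \<epsilon>\<close> unfolding PiM_P1 by (intro measure_ge) auto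
  have 2: "?k * Tn.prob (A \<inter> ?W) \<le> measure (PiM {..<n} (\<lambda>_. P2)) A"
    using D2 l \<open>0 \<le> \<epsilon>\<close> unfolding PiM_P2 by (intro measure_ge) auto
  have "Tn.prob ?W = Tn.prob (((space (Tn n) - A) \<inter> ?W) \<union> (A \<inter> ?W))"
    by (intro arg_cong[where f=Tn.prob]) auto
  also have "\<dots> = Tn.prob ((space (Tn n) - A) \<inter> ?W) + Tn.prob (A \<inter> ?W)"
    by (intro Tn.finite_measure_Union) auto
  finally have "min \<pi>1 \<pi>2 * ?k * Tn.prob ?W =
      min \<pi>1 \<pi>2 * (?k * Tn.prob ((space (Tn n) - A) \<inter> ?W)) + min \<pi>1 \<pi>2 * (?k * Tn.prob (A \<inter> ?W))"
    by (simp add: algebra_simps)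
  also have "\<dots> \<le> \<pi>1 * measure (PiM {..<n} (\<lambda>_. P1)) (space (Tn n) - A)
      + \<pi>2 * measure (PiM {..<n} (\<lambda>_. P2)) A"
    using prior c by (intro add_mono mult_mono 1 2) (auto intro!: mult_nonneg_nonneg)
  finally show ?thesis by (simp add: mult.assoc)
qed

end

section \<open>Exponential rates from geometric bounds\<close>

text \<open>The factors \<open>K\<close>, \<open>p\<close> and \<open>W \<epsilon> n\<close>
  disappear on the exponential scale, and \<epsilon> is arbitrary.\<close>

lemma neg_log_rate_tendsto:
  fixes e :: "nat \<Rightarrow> real"
  assumes "c > 0" "K > 0" "p > 0"
    and upper: "\<And>n. n \<ge> m \<Longrightarrow> e n \<le> K * c ^ n"
    and lower: "\<And>\<epsilon> n. \<epsilon> > 0 \<Longrightarrow> n \<ge> m \<Longrightarrow> p * c ^ n * exp (- (n * \<epsilon>)) * W \<epsilon> n \<le> e n"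
    and W: "\<And>\<epsilon>. \<epsilon> > 0 \<Longrightarrow> W \<epsilon> \<longlonglongrightarrow> 1"
  shows "(\<lambda>n. neg_log_rate n (e n)) \<longlonglongrightarrow> ereal (- ln c)"
proof -
  have low: "eventually (\<lambda>n. n \<ge> m \<and> n > 0 \<and> p / 2 * c ^ n * exp (- (n * \<epsilon>)) \<le> e n) sequentially"
    if "\<epsilon> > 0" for \<epsilon> :: real
  proof -
    have "eventually (\<lambda>n. 1 / 2 < W \<epsilon> n) sequentially"
      using W[OF that] by (rule order_tendstoD) simp
    then show ?thesis using eventually_ge_at_top[of m] eventually_gt_at_top[of 0]
    proof eventually_elim
      case (elim n)
      have "p * c ^ n * exp (- (n * \<epsilon>)) * (1 / 2) \<le> p * c ^ n * exp (- (n * \<epsilon>)) * W \<epsilon> n"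
        using elim \<open>p > 0\<close> \<open>c > 0\<close> by (intro mult_left_mono) auto
      also have "\<dots> \<le> e n" using lower[OF that] elim by simp
      finally show ?case using elim by simp
    qed
  qed
  have e_pos: "e n > 0" if "p / 2 * c ^ n * exp (- (n * \<epsilon>)) \<le> e n" for n and \<epsilon> :: real
    using that \<open>p > 0\<close> \<open>c > 0\<close> by (smt (verit) mult_pos_pos zero_less_power exp_gt_zero half_gt_zero)
  have "(\<lambda>n. - (1 / real n) * ln (e n)) \<longlonglongrightarrow> - ln c"
  proof (rule tendstoI)
    fix \<delta> :: real assume "\<delta> > 0"
    \<comment> \<open>Half of \<delta> pays for the constants \<open>K\<close> and
      \<open>p / 2\<close>; the other half is the \<epsilon> of the lower bound.\<close>
    have "eventually (\<lambda>n. \<bar>ln K / real n\<bar> < \<delta> / 2) sequentially"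
      "eventually (\<lambda>n. \<bar>ln (p / 2) / real n\<bar> < \<delta> / 2) sequentially"
      using \<open>\<delta> > 0\<close> by (auto intro!: order_tendstoD(2)[where y=0] tendsto_rabs_zero lim_const_over_n)
    moreover have "eventually (\<lambda>n. n \<ge> m \<and> n > 0 \<and> p / 2 * c ^ n * exp (- (n * (\<delta> / 2))) \<le> e n) sequentially"
      using low[of "\<delta> / 2"] \<open>\<delta> > 0\<close> by simp
    ultimately show "eventually (\<lambda>n. dist (- (1 / real n) * ln (e n)) (- ln c) < \<delta>) sequentially"
    proof eventually_elim
      case (elim n)
      then have n: "n \<ge> m" "n > 0" and le: "p / 2 * c ^ n * exp (- (n * (\<delta> / 2))) \<le> e n" by auto
      have "e n > 0" using e_pos[OF le] .
      have "ln (e n) \<le> ln (K * c ^ n)" using upper[OF n(1)] \<open>e n > 0\<close> by simp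
      also have "\<dots> = ln K + n * ln c" using \<open>K > 0\<close> \<open>c > 0\<close> by (simp add: ln_mult ln_realpow)
      finally have "ln (e n) / n \<le> (ln K + n * ln c) / n" by (intro divide_right_mono) auto
      then have 1: "ln (e n) / n \<le> ln K / n + ln c" using n by (simp add: add_divide_distrib)
      have "ln (p / 2 * c ^ n * exp (- (n * (\<delta> / 2)))) \<le> ln (e n)"
        using le \<open>p > 0\<close> \<open>c > 0\<close> by (subst ln_le_cancel_iff) (auto simp: \<open>e n > 0\<close>)
      moreover have "ln (p / 2 * c ^ n * exp (- (n * (\<delta> / 2)))) = ln (p / 2) + n * ln c - n * (\<delta> / 2)"
        using \<open>c > 0\<close> half_gt_zero[OF \<open>p > 0\<close>] by (simp only: ln_mult_pos ln_realpow ln_exp mult_pos_pos zero_less_power exp_gt_zero)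
      ultimately have "(ln (p / 2) + n * ln c - n * (\<delta> / 2)) / n \<le> ln (e n) / n"
        by (intro divide_right_mono) auto
      then have "ln (p / 2) / n + ln c - \<delta> / 2 \<le> ln (e n) / n"
        using n by (simp add: add_divide_distrib diff_divide_distrib)
      moreover have "- (1 / real n) * ln (e n) = - (ln (e n) / n)" by simp
      ultimately show ?case using 1 elim(1,2) unfolding dist_real_def by linarith
    qed
  qed
  then have "(\<lambda>n. ereal (- (1 / real n) * ln (e n))) \<longlonglongrightarrow> ereal (- ln c)"
    by (rule tendsto_ereal)
  \<comment> \<open>The lower bound, taken at \<epsilon> = 1, makes \<open>e n\<close> eventually
    positive, so \<open>neg_log_rate\<close> avoids its value \<open>\<infinity>\<close>.\<close>
  moreover have "eventually (\<lambda>n. ereal (- (1 / real n) * ln (e n)) = neg_log_rate n (e n)) sequentially"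
    using low[OF zero_less_one] by eventually_elim (use e_pos[of _ 1] in \<open>force simp: neg_log_rate_def\<close>)
  ultimately show ?thesis by (rule Lim_transform_eventually)
qed

section \<open>Moment generating function of the log-likelihood ratio\<close>

text \<open>One bound for all \<open>s\<close> in the unit interval, serving as integrable majorant
  of all tilts.\<close>

lemma exp_mult_le:
  fixes s u :: real
  assumes "0 \<le> s" "s \<le> 1"
  shows "exp (s * u) \<le> 1 + exp u"
proof (cases "u \<ge> 0")
  case True
  then have "s * u \<le> 1 * u" using assms by (intro mult_right_mono) auto
  then have "exp (s * u) \<le> exp u" by simp
  then show ?thesis by linarith
next
  case False
  then have "s * u \<le> 0" using assms by (simp add: mult_nonneg_nonpos)
  then have "exp (s * u) \<le> 1" by simp
  then show ?thesis using exp_gt_zero[of u] by linarith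
qed

locale likelihood_ratio = prob_space N for N :: "'a measure" +
  fixes f :: "'a \<Rightarrow> real"
  assumes f_measurable [measurable]: "f \<in> borel_measurable N"
    and prob_density: "prob_space (density N (\<lambda>x. ennreal (exp (f x))))"
begin

text \<open>With \<open>N\<close> as the second hypothesis this is the Chernoff integral of
  \<open>p1 powr s * p2 powr (1 - s)\<close>.\<close>

definition mgf :: "real \<Rightarrow> real" where "mgf s = (\<integral>x. exp (s * f x) \<partial>N)"

lemma nn_integral_exp: "(\<integral>\<^sup>+x. ennreal (exp (f x)) \<partial>N) = 1"
  using prob_space.emeasure_space_1[OF prob_density]
  by (simp add: emeasure_density cong: nn_integral_cong)

lemma integrable_exp: "integrable N (\<lambda>x. exp (f x))"
  by (intro integrableI_nonneg) (auto simp: nn_integral_exp)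

lemma integrable_exp_mult:
  assumes "0 \<le> s" "s \<le> 1"
  shows "integrable N (\<lambda>x. exp (s * f x))"
proof (rule Bochner_Integration.integrable_bound)
  show "integrable N (\<lambda>x. 1 + exp (f x))" using integrable_exp by simp
  show "AE x in N. norm (exp (s * f x)) \<le> norm (1 + exp (f x))"
    using exp_mult_le[OF assms] by (intro AE_I2) (simp add: add_nonneg_nonneg)
qed simp

lemma mgf_0: "mgf 0 = 1" by (simp add: mgf_def prob_space)

lemma mgf_1: "mgf 1 = 1"
  using nn_integral_eq_integral[OF integrable_exp] nn_integral_exp
  by (simp add: mgf_def ennreal_eq_1)

lemma mgf_pos:
  assumes "0 \<le> s" "s \<le> 1"
  shows "0 < mgf s"
proof -
  have "mgf s \<noteq> 0"
  proof
    assume "mgf s = 0"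
    then have "AE x in N. exp (s * f x) = 0"
      using integral_nonneg_eq_0_iff_AE[OF integrable_exp_mult[OF assms]] by (simp add: mgf_def)
    then show False using AE_False by simp
  qed
  moreover have "0 \<le> mgf s" unfolding mgf_def by (intro integral_nonneg_AE) auto
  ultimately show ?thesis by simp
qed

lemma continuous_on_mgf: "continuous_on {0..1} mgf"
proof (rule continuous_on_sequentiallyI)
  fix u a assume u: "\<forall>n. u n \<in> {0..1::real}" and "a \<in> {0..1}" and lim: "u \<longlonglongrightarrow> a"
  show "(\<lambda>n. mgf (u n)) \<longlonglongrightarrow> mgf a"
    unfolding mgf_def
  proof (rule integral_dominated_convergence[where w="\<lambda>x. 1 + exp (f x)"])
    show "AE x in N. (\<lambda>n. exp (u n * f x)) \<longlonglongrightarrow> exp (a * f x)"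
      by (intro AE_I2 tendsto_intros lim)
    show "AE x in N. norm (exp (u n * f x)) \<le> 1 + exp (f x)" for n
      using u exp_mult_le[of "u n"] by (intro AE_I2) auto
  qed (use integrable_exp in auto)
qed

text \<open>Continuity on a compact interval gives a minimiser. At both endpoints \<open>mgf\<close>
  is 1 with logarithm 0, so positive Chernoff information forces it into the interior.\<close>

lemma minimizer:
  assumes "0 < - (INF s\<in>{0..1}. ln (mgf s))"
  obtains l where "0 < l" "l < 1" "- (INF s\<in>{0..1}. ln (mgf s)) = - ln (mgf l)"
    "\<And>s. 0 \<le> s \<Longrightarrow> s \<le> 1 \<Longrightarrow> mgf l \<le> mgf s"
proof -
  obtain l where l: "l \<in> {0..1}" and min: "\<And>s. s \<in> {0..1} \<Longrightarrow> mgf l \<le> mgf s"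
    using continuous_attains_inf[OF _ _ continuous_on_mgf] by auto
  have "(INF s\<in>{0..1}. ln (mgf s)) = ln (mgf l)"
  proof (rule cInf_eq_minimum)
    show "ln (mgf l) \<in> (\<lambda>s. ln (mgf s)) ` {0..1}" using l by auto
    show "ln (mgf l) \<le> x" if "x \<in> (\<lambda>s. ln (mgf s)) ` {0..1}" for x
      using that min l mgf_pos by auto
  qed
  moreover from this have "l \<noteq> 0" "l \<noteq> 1" using assms by (auto simp: mgf_0 mgf_1)
  ultimately show ?thesis using that[of l] l min by auto
qed

end

text \<open>The tilted measure at the minimiser of the moment generating function \<open>mgf\<close> on the
  unit interval: its own moment generating function \<open>h \<mapsto> mgf (l + h) / mgf l\<close> is minimal at \<open>0\<close>,
  which is what makes the sample means concentrate at \<open>0\<close>.\<close>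

locale tilted_minimizer = likelihood_ratio +
  fixes l :: real
  assumes l: "0 < l" "l < 1" and min: "\<And>s. 0 \<le> s \<Longrightarrow> s \<le> 1 \<Longrightarrow> mgf l \<le> mgf s"
begin

definition T :: "'a measure" where "T = density N (\<lambda>x. ennreal (exp (l * f x) / mgf l))"

lemma mgf_l: "0 < mgf l" using mgf_pos l by simp

lemma f_measurable_T [measurable]: "f \<in> borel_measurable T"
  by (simp add: T_def)

lemma prob_space_T: "prob_space T"
proof
  have "emeasure T (space T) = (\<integral>\<^sup>+x. ennreal (exp (l * f x) / mgf l) \<partial>N)"
    by (simp add: T_def emeasure_density cong: nn_integral_cong)
  also have "\<dots> = ennreal (\<integral>x. exp (l * f x) / mgf l \<partial>N)"
    using integrable_exp_mult l mgf_l by (intro nn_integral_eq_integral) auto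
  also have "(\<integral>x. exp (l * f x) / mgf l \<partial>N) = 1" using mgf_l by (simp flip: mgf_def)
  finally show "emeasure T (space T) = 1" by simp
qed

text \<open>Tilts compose by adding exponents: \<open>b = 1 - l\<close> recovers the first
  hypothesis and \<open>b = - l\<close> recovers \<open>N\<close>.\<close>

lemma density_T: "density T (\<lambda>x. ennreal (mgf l * exp (b * f x))) = density N (\<lambda>x. ennreal (exp ((l + b) * f x)))"
proof -
  have "ennreal (exp (l * f x) / mgf l) * ennreal (mgf l * exp (b * f x)) = ennreal (exp ((l + b) * f x))" for x
    using mgf_l by (simp add: exp_add distrib_right flip: ennreal_mult)
  then show ?thesis unfolding T_def by (subst density_density_eq) auto
qed

lemma tilted_pair: "tilted_pair T f l (mgf l) (density N (\<lambda>x. ennreal (exp (f x)))) N"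
proof (intro tilted_pair.intro tilted_pair_axioms.intro)
  show "density N (\<lambda>x. ennreal (exp (f x))) = density T (\<lambda>x. ennreal (mgf l * exp ((1 - l) * f x)))"
    unfolding density_T by simp
  have "density T (\<lambda>x. ennreal (mgf l * exp (- l * f x))) = N"
    unfolding density_T by (simp add: density_1)
  then show "N = density T (\<lambda>x. ennreal (mgf l * exp (- l * f x)))" by (rule sym)
  show "0 \<le> l" "l \<le> 1" using l by simp_all
qed (fact prob_space_T f_measurable_T mgf_l prob_density prob_space_axioms)+

lemma
  assumes "0 \<le> l + h" "l + h \<le> 1"
  shows integrable_T_exp: "integrable T (\<lambda>x. exp (h * f x))"
    and one_le_integral_T_exp: "1 \<le> (\<integral>x. exp (h * f x) \<partial>T)"
proof -
  have eq: "exp (l * f x) * exp (h * f x) = exp ((l + h) * f x)" for x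
    by (simp add: distrib_right exp_add)
  show "integrable T (\<lambda>x. exp (h * f x))"
    unfolding T_def using mgf_l integrable_exp_mult[OF assms] by (subst integrable_density) (auto simp: eq)
  have "(\<integral>x. exp (h * f x) \<partial>T) = mgf (l + h) / mgf l"
    unfolding T_def using mgf_l by (subst integral_density) (auto simp: eq mgf_def)
  then show "1 \<le> (\<integral>x. exp (h * f x) \<partial>T)" using min[OF assms] mgf_l by simp
qed

text \<open>The upper bound uses that \<open>A n\<close> nearly agrees with the likelihood ratio
  test, the lower bound that \<open>S\<close> concentrates under \<open>T\<close>.\<close>

lemma error_rate:
  assumes prior: "\<pi>1 > 0" "\<pi>2 > 0" "\<pi>1 + \<pi>2 = 1"
    and A: "\<And>n. n \<ge> m \<Longrightarrow> A n \<in> sets (PiM {..<n} (\<lambda>_. N))"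
    and S1: "\<And>n y. n \<ge> m \<Longrightarrow> y \<in> A n \<Longrightarrow> -1 \<le> (\<Sum>i<n. f (y i))"
    and S2: "\<And>n y. n \<ge> m \<Longrightarrow> y \<in> space (PiM {..<n} (\<lambda>_. N)) - A n \<Longrightarrow> (\<Sum>i<n. f (y i)) \<le> 1"
  shows "(\<lambda>n. neg_log_rate n
      (\<pi>1 * measure (PiM {..<n} (\<lambda>_. density N (\<lambda>x. ennreal (exp (f x))))) (space (PiM {..<n} (\<lambda>_. N)) - A n)
       + \<pi>2 * measure (PiM {..<n} (\<lambda>_. N)) (A n))) \<longlonglongrightarrow> ereal (- ln (mgf l))"
    (is "(\<lambda>n. neg_log_rate n (?e n)) \<longlonglongrightarrow> _")
proof -
  interpret tp: tilted_pair T f l "mgf l" "density N (\<lambda>x. ennreal (exp (f x)))" N by (rule tilted_pair)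
  have space_eq: "space (PiM {..<n} (\<lambda>_. N)) = space (tp.Tn n)" for n
    by (simp add: space_PiM T_def)
  have sets_eq: "sets (PiM {..<n} (\<lambda>_. N)) = sets (tp.Tn n)" for n
    by (rule tp.sets_PiM_Pi(2))
  show ?thesis
  proof (rule neg_log_rate_tendsto[where K="exp 1" and p="min \<pi>1 \<pi>2" and m=m
        and W="\<lambda>\<epsilon> n. measure (tp.Tn n) {y \<in> space (tp.Tn n). \<bar>tp.S n y\<bar> \<le> n * \<epsilon>}"])
    show "(\<lambda>n. measure (tp.Tn n) {y \<in> space (tp.Tn n). \<bar>tp.S n y\<bar> \<le> n * \<epsilon>}) \<longlonglongrightarrow> 1"
      if "\<epsilon> > 0" for \<epsilon> :: real
      unfolding tp.S_def
    \<comment> \<open>This radius keeps \<open>l + h\<close> inside the unit interval, where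
      \<open>l\<close> is minimal.\<close>
    proof (rule tp.weak_law_exp_moment[where a="min l (1 - l)"])
      fix h assume "\<bar>h\<bar> \<le> min l (1 - l)"
      then show "integrable T (\<lambda>x. exp (h * f x))" "1 \<le> (\<integral>x. exp (h * f x) \<partial>T)"
        by (auto intro!: integrable_T_exp one_le_integral_T_exp)
    qed (use l that in auto)
    show "min \<pi>1 \<pi>2 * mgf l ^ n * exp (- (n * \<epsilon>))
        * measure (tp.Tn n) {y \<in> space (tp.Tn n). \<bar>tp.S n y\<bar> \<le> n * \<epsilon>} \<le> ?e n"
      if "\<epsilon> > 0" "n \<ge> m" for \<epsilon> :: real and n
      unfolding space_eq using prior A[OF that(2)] that(1)
      by (intro tp.error_lower_bound) (auto simp: sets_eq)
    show "?e n \<le> exp 1 * mgf l ^ n" if "n \<ge> m" for n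
      unfolding space_eq using prior A[OF that] S1[OF that] S2[OF that]
      by (intro tp.error_upper_bound) (auto simp: sets_eq space_eq tp.S_def)
  qed (use prior mgf_l in auto)
qed

end

subsection \<open>The Chernoff rate of BQ-CADMM\<close>

theorem theorem4:
  fixes mu :: "'a::polish_space measure"
    and p1 p2 :: "'a \<Rightarrow> real"
    and \<pi>1 \<pi>2 :: real
    and G :: "nat \<Rightarrow> nat \<Rightarrow> nat \<Rightarrow> bool"
  assumes sets_mu: "sets mu = sets borel"
    and p1_meas: "p1 \<in> borel_measurable mu" and p2_meas: "p2 \<in> borel_measurable mu"
    and p1_nonneg: "\<And>x. p1 x \<ge> 0" and p2_nonneg: "\<And>x. p2 x \<ge> 0"
    and P1_prob: "prob_space (density mu (\<lambda>x. ennreal (p1 x)))"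
    and P2_prob: "prob_space (density mu (\<lambda>x. ennreal (p2 x)))"
    and ac12: "absolutely_continuous (density mu (\<lambda>x. ennreal (p1 x))) (density mu (\<lambda>x. ennreal (p2 x)))"
    and ac21: "absolutely_continuous (density mu (\<lambda>x. ennreal (p2 x))) (density mu (\<lambda>x. ennreal (p1 x)))"
    and prior: "\<pi>1 > 0" "\<pi>2 > 0" "\<pi>1 + \<pi>2 = 1"
    and C_pos: "chernoff mu p1 p2 > 0"
    and graphs: "\<And>n. n \<ge> 2 \<Longrightarrow> connected_graph n (G n)"
  shows
    "liminf (\<lambda>n.
       let P1 = density mu (\<lambda>x. ennreal (p1 x));
           P2 = density mu (\<lambda>x. ennreal (p2 x));
           Q = quant (-1) 2 1;
           \<rho> = 1 / (12 * (real n)\<^sup>2);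
           r = (\<lambda>y :: nat \<Rightarrow> 'a. \<lambda>i. ln (p1 (y i) / p2 (y i)));
           A = {y \<in> space (PiM {..<n} (\<lambda>_. mu)).
                  cycles (-1) 2 n (G n) Q \<rho> (r y) \<or> converges_at n (G n) Q \<rho> (r y) 1};
           \<alpha> = measure (PiM {..<n} (\<lambda>_. P1)) (space (PiM {..<n} (\<lambda>_. P1)) - A);
           \<beta> = measure (PiM {..<n} (\<lambda>_. P2)) A
       in neg_log_rate n (\<pi>1 * \<alpha> + \<pi>2 * \<beta>))
     = ereal (chernoff mu p1 p2)"
proof -
  note [measurable] = p1_meas p2_meas
  define f where "f x = ln (p1 x / p2 x)" for x
  have [measurable]: "f \<in> borel_measurable mu" unfolding f_def by measurable
  define P2 where "P2 = density mu (\<lambda>x. ennreal (p2 x))"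
  \<comment> \<open>The zero set of each density is null for its own measure, hence by mutual
    absolute continuity for the other one.\<close>
  have same_null: "AE x in mu. p1 x = 0 \<longleftrightarrow> p2 x = 0"
  proof -
    have "{x \<in> space mu. p2 x = 0} \<in> null_sets (density mu (\<lambda>x. ennreal (p2 x)))"
      "{x \<in> space mu. p1 x = 0} \<in> null_sets (density mu (\<lambda>x. ennreal (p1 x)))"
      by (auto simp: null_sets_density_iff)
    then have "{x \<in> space mu. p2 x = 0} \<in> null_sets (density mu (\<lambda>x. ennreal (p1 x)))"
      "{x \<in> space mu. p1 x = 0} \<in> null_sets (density mu (\<lambda>x. ennreal (p2 x)))"
      using ac12 ac21 by (auto simp: absolutely_continuous_def)
    then have "AE x in mu. p2 x = 0 \<longrightarrow> p1 x = 0" "AE x in mu. p1 x = 0 \<longrightarrow> p2 x = 0"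
      using p1_nonneg p2_nonneg by (auto simp: null_sets_density_iff ennreal_eq_0_iff order_antisym)
    then show ?thesis by eventually_elim auto
  qed
  \<comment> \<open>At common zeros both sides vanish even for \<open>s = 0\<close> or
    \<open>s = 1\<close>, because \<open>0 powr 0 = 0\<close>.\<close>
  have tilt: "AE x in mu. p1 x powr s * p2 x powr (1 - s) = p2 x * exp (s * f x)" for s
    using same_null
  proof eventually_elim
    case (elim x)
    show ?case
    proof (cases "p2 x = 0")
      case False
      then have "p1 x > 0" "p2 x > 0" using elim p1_nonneg[of x] p2_nonneg[of x] by auto
      then show ?thesis
        by (simp add: f_def powr_def ln_div exp_add exp_diff algebra_simps flip: exp_add)
    qed (use elim in simp)
  qed
  have P1_eq: "density mu (\<lambda>x. ennreal (p1 x)) = density P2 (\<lambda>x. ennreal (exp (f x)))"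
    unfolding P2_def
  proof (subst density_density_eq)
    show "density mu (\<lambda>x. ennreal (p1 x)) = density mu (\<lambda>x. ennreal (p2 x) * ennreal (exp (f x)))"
    proof (rule density_cong)
      show "AE x in mu. ennreal (p1 x) = ennreal (p2 x) * ennreal (exp (f x))"
        using tilt[of 1] same_null
        by eventually_elim (use p1_nonneg p2_nonneg in \<open>auto simp flip: ennreal_mult split: if_splits\<close>)
    qed auto
  qed auto
  interpret P2: prob_space P2 unfolding P2_def by (rule P2_prob)
  interpret lr: likelihood_ratio P2 f
    using P1_prob unfolding P1_eq
    by (intro likelihood_ratio.intro likelihood_ratio_axioms.intro P2.prob_space_axioms) (auto simp: P2_def)
  have "(\<integral>x. p1 x powr s * p2 x powr (1 - s) \<partial>mu) = lr.mgf s" for s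
  proof -
    have "lr.mgf s = (\<integral>x. p2 x * exp (s * f x) \<partial>mu)"
      unfolding lr.mgf_def unfolding P2_def using p2_nonneg by (subst integral_density) auto
    then show ?thesis using tilt[of s] by (simp add: integral_cong_AE)
  qed
  then have chernoff: "chernoff mu p1 p2 = - (INF s\<in>{0..1}. ln (lr.mgf s))"
    by (simp add: chernoff_def)
  obtain l where l: "0 < l" "l < 1" "chernoff mu p1 p2 = - ln (lr.mgf l)"
    "\<And>s. 0 \<le> s \<Longrightarrow> s \<le> 1 \<Longrightarrow> lr.mgf l \<le> lr.mgf s"
    using lr.minimizer C_pos unfolding chernoff by metis
  interpret tm: tilted_minimizer P2 f l by unfold_locales (use l in auto)
  define Q where "Q = quant (-1) 2 1"
  define \<rho> where "\<rho> n = 1 / (12 * (real n)\<^sup>2)" for n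
  define R where "R = (\<lambda>(y :: nat \<Rightarrow> 'a) i. ln (p1 (y i) / p2 (y i)))"
  have R_apply: "R y i = f (y i)" for y i by (simp add: R_def f_def)
  define A where "A n = {y \<in> space (PiM {..<n} (\<lambda>_. mu)).
      cycles (-1) 2 n (G n) Q (\<rho> n) (R y) \<or> converges_at n (G n) Q (\<rho> n) (R y) 1}" for n
  have space_P2: "space (PiM {..<n} (\<lambda>_. P2)) = space (PiM {..<n} (\<lambda>_. mu))" for n :: nat
    by (simp add: space_PiM P2_def)
  have [measurable]: "Q \<in> borel_measurable borel"
    unfolding Q_def quant_def by measurable
  have A_meas: "A n \<in> sets (PiM {..<n} (\<lambda>_. P2))" for n
  proof -
    have "(\<lambda>y. R y i) \<in> borel_measurable (PiM {..<n} (\<lambda>_. P2))" if "i < n" for i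
      unfolding R_apply by (rule measurable_compose[OF measurable_component_singleton]) (use that in auto)
    then have [measurable]: "Measurable.pred (PiM {..<n} (\<lambda>_. P2)) (\<lambda>y. converges_at n (G n) Q (\<rho> n) (R y) c)" for c
      by (intro converges_at_measurable) auto
    show ?thesis unfolding A_def cycles_def space_P2[symmetric] by measurable
  qed
  have bounds: "y \<in> A n \<Longrightarrow> -1 \<le> (\<Sum>i<n. f (y i))"
    "y \<in> space (PiM {..<n} (\<lambda>_. P2)) - A n \<Longrightarrow> (\<Sum>i<n. f (y i)) \<le> 1" if "n \<ge> 2" for n y
  proof -
    interpret sign_bqcadmm n "G n" "\<rho> n" "R y"
      by unfold_locales (use graphs that in \<open>auto simp: \<rho>_def\<close>)
    \<comment> \<open>The two bounds on the sum thus become -1/3 and 1/6, well within -1 and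
      1.\<close>
    have \<rho>n: "\<rho> n * (real n)\<^sup>2 = 1 / 12" using that by (simp add: \<rho>_def)
    \<comment> \<open>Node 0 cannot settle at both values. Hence \<open>A n\<close> is exactly the
      event of not converging at -1.\<close>
    have not_both: "\<not> (converges_at n (G n) Q (\<rho> n) (R y) 1 \<and> converges_at n (G n) Q (\<rho> n) (R y) (-1))"
    proof
      assume "converges_at n (G n) Q (\<rho> n) (R y) 1 \<and> converges_at n (G n) Q (\<rho> n) (R y) (-1)"
      then obtain k1 k2 where
        "\<forall>k\<ge>k1. \<forall>i<n. Q (fst (bqcadmm n (G n) Q (\<rho> n) (R y) k) i) = 1"
        "\<forall>k\<ge>k2. \<forall>i<n. Q (fst (bqcadmm n (G n) Q (\<rho> n) (R y) k) i) = -1"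
        by (auto simp: converges_at_def)
      from this(1)[rule_format, of "max k1 k2" 0] this(2)[rule_format, of "max k1 k2" 0] that
      show False by simp
    qed
    show "-1 \<le> (\<Sum>i<n. f (y i))" if "y \<in> A n"
    proof -
      have "\<not> converges_at n (G n) Q (\<rho> n) (R y) (-1)"
        using that not_both by (auto simp: A_def cycles_def)
      from not_converges_neg[OF this[unfolded Q_def]] show ?thesis using \<rho>n by (simp add: R_apply)
    qed
    show "(\<Sum>i<n. f (y i)) \<le> 1" if "y \<in> space (PiM {..<n} (\<lambda>_. P2)) - A n"
    proof -
      have "converges_at n (G n) Q (\<rho> n) (R y) (-1)"
        using that by (auto simp: A_def cycles_def space_P2)
      from converges_neg[OF this[unfolded Q_def]] show ?thesis using \<rho>n by (simp add: R_apply)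
    qed
  qed
  have "(\<lambda>n. neg_log_rate n
      (\<pi>1 * measure (PiM {..<n} (\<lambda>_. density P2 (\<lambda>x. ennreal (exp (f x))))) (space (PiM {..<n} (\<lambda>_. P2)) - A n)
       + \<pi>2 * measure (PiM {..<n} (\<lambda>_. P2)) (A n))) \<longlonglongrightarrow> ereal (chernoff mu p1 p2)"
    unfolding l(3) by (rule tm.error_rate[where m=2]) (use prior A_meas bounds in auto)
  then have "(\<lambda>n. neg_log_rate n
      (\<pi>1 * measure (PiM {..<n} (\<lambda>_. density mu (\<lambda>x. ennreal (p1 x))))
        (space (PiM {..<n} (\<lambda>_. density mu (\<lambda>x. ennreal (p1 x)))) - A n)
       + \<pi>2 * measure (PiM {..<n} (\<lambda>_. P2)) (A n))) \<longlonglongrightarrow> ereal (chernoff mu p1 p2)"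
    unfolding P1_eq by (simp only: space_PiM space_density)
  \<comment> \<open>The rate is a genuine limit, so the liminf equals it.\<close>
  from lim_imp_Liminf[OF trivial_limit_sequentially this] show ?thesis
    unfolding Let_def A_def Q_def \<rho>_def R_def P2_def .
qed

end
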